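(* Let $E/\mathbb Q(t)$ be the elliptic curve $y^2=x^3-t^2x+t^2$. Let $t_0\in\mathbb N$ with $t_0>1$ and $t_0\equiv 1\pmod 4$. Then the specialization map $\sigma_{t_0}:E(\mathbb Q(t))\to E_{t_0}(\mathbb Q)$ is injective.
   Context: $E_{t_0}$ is the elliptic curve $y^2=x^3-t_0^2x+t_0^2$ over $\mathbb Q$ and $\sigma_{t_0}$ is the specialization homomorphism $(x(t),y(t))\mapsto(x(t_0),y(t_0))$. *)

theory Defs
  imports "HOL-Computational_Algebra.Computational_Algebra" "HOL-Computational_Algebra.Field_as_Ring"
begin

type_synonym ratfun = "rat poly fract"

definition tvar :: ratfun where
  "tvar = to_fract [:0, 1:]"

text \<open>Points of E over Q(t): None is the point at infinity O, Some (x,y) an affine point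
  of y^2 = x^3 - t^2 x + t^2.\<close>
definition E_Qt_points :: "(ratfun \<times> ratfun) option set" where
  "E_Qt_points = {None} \<union>
     {Some (x, y) | x y. y ^ 2 = x ^ 3 - tvar ^ 2 * x + tvar ^ 2}"

definition E_points :: "rat \<Rightarrow> (rat \<times> rat) option set" where
  "E_points t0 = {None} \<union>
     {Some (x, y) | x y. y ^ 2 = x ^ 3 - t0 ^ 2 * x + t0 ^ 2}"

text \<open>A rational function (in lowest terms p/q) has a pole at t0 iff q(t0) = 0;
  otherwise its value at t0 is p(t0)/q(t0).\<close>
definition has_pole_at :: "rat \<Rightarrow> ratfun \<Rightarrow> bool" where
  "has_pole_at t0 f = (poly (snd (quot_of_fract f)) t0 = 0)"

definition eval_at :: "rat \<Rightarrow> ratfun \<Rightarrow> rat" where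
  "eval_at t0 f = poly (fst (quot_of_fract f)) t0 / poly (snd (quot_of_fract f)) t0"

definition specialize :: "rat \<Rightarrow> (ratfun \<times> ratfun) option \<Rightarrow> (rat \<times> rat) option" where
  "specialize t0 P = (case P of
       None \<Rightarrow> None
     | Some (x, y) \<Rightarrow> if has_pole_at t0 x then None else Some (eval_at t0 x, eval_at t0 y))"

end

theory Submission
  imports Defs
begin

text \<open>
  Put \<open>s = 1/t\<close>, so that the curve becomes \<open>Y^2 = X^3 - s^2 X + s^4\<close> with \<open>X = s^2 x\<close>, \<open>Y = s^3 y\<close>.
  The cubic has the root \<open>X = u s\<close> in the field obtained by adjoining a root of \<open>u^3 - u + s = 0\<close>,
  and this field is the rational function field \<open>\<rat>(u)\<close>, with \<open>s = u - u^3\<close>.  Hence 2-descent takes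
  place in the factorial ring \<open>\<rat>[u]\<close>.  For a point \<open>X = A/D^2\<close> in lowest terms it shows that
  \<open>A - u s D^2\<close>, up to squares, is \<open>1\<close> or \<open>s (eps - u)\<close> with \<open>eps \<in> {0, 1, -1}\<close>; the latter are the
  classes of the points \<open>(eps t, t)\<close>.

  Suppose \<open>X\<close> has a pole at \<open>s0 = 1/t0\<close>.  A nontrivial class would make a multiple of \<open>eps - u\<close> a square modulo
  \<open>u^3 - u + s0\<close>, which is impossible: for \<open>eps = 0, -1\<close> because a quartic is positive when
  \<open>t0 \<ge> 5\<close>, for \<open>eps = 1\<close> by a parity argument using \<open>t0 \<equiv> 1\<close> modulo 4.  So the class is
  trivial, the point is twice another point, which again has a pole at \<open>s0\<close> (the cubic has no
  root in \<open>\<rat>\<close> at \<open>t0\<close>) and has smaller degree: infinite descent.  Hence no affine point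
  specializes to infinity.  If two different points had the same specialization, their
  difference would.
\<close>

section \<open>Rational arithmetic at \<open>t0\<close>\<close>

lemma rat_quotient_of_int:
  fixes e :: rat
  obtains p q :: int where "q \<noteq> 0" "coprime p q" "e = of_int p / of_int q"
proof -
  obtain p q where pq: "quotient_of e = (p, q)" by fastforce
  show ?thesis
    by (rule that[of q p])
      (use quotient_of_div[OF pq] quotient_of_denom_pos[OF pq] quotient_of_coprime[OF pq] in simp_all)
qed

text \<open>Modulo 2 the cleared equation forces \<open>p\<close> and \<open>q\<close> to be both
  even. It means that the curve at \<open>t0\<close> has no rational point of order 2.\<close>

lemma cubic_no_rational_root:
  fixes e :: rat and t0 :: nat
  assumes "odd t0"
  shows "e ^ 3 - e + 1 / of_nat t0 \<noteq> 0"
proof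
  assume h: "e ^ 3 - e + 1 / of_nat t0 = 0"
  obtain p q :: int where q: "q \<noteq> 0" and cop: "coprime p q" and e: "e = of_int p / of_int q"
    by (rule rat_quotient_of_int)
  have t: "(of_nat t0 :: rat) \<noteq> 0" using assms by (auto elim: oddE)
  have "of_int (int t0 * (p^3 - p * q^2) + q^3) = (0 :: rat)"
    using h q t unfolding e by (simp add: field_simps power2_eq_square power3_eq_cube)
  hence eq: "int t0 * (p^3 - p * q^2) + q^3 = 0" by (simp only: of_int_eq_0_iff)
  have "even (int t0 * (p^3 - p * q^2) + q^3)" unfolding eq by simp
  moreover have "\<not> (even p \<and> even q)" using cop by (meson coprime_common_divisor odd_one)
  ultimately show False using assms by auto
qed

text \<open>Clearing denominators forces \<open>p\<close> and \<open>q\<close> to be odd. Cancelling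
  4 leaves \<open>t0\<close> times an odd square, which is 1 modulo 4, against
  \<open>q^3 * (2*p + q)\<close>, which is 3.\<close>

lemma quartic_one_no_rational_root:
  fixes e :: rat and t0 :: nat
  assumes "t0 mod 4 = 1"
  shows "of_nat t0 * (e^2 - 2 * e - 1)^2 \<noteq> 8 * e + 4"
proof
  assume h: "of_nat t0 * (e^2 - 2 * e - 1)^2 = 8 * e + 4"
  obtain p q :: int where q: "q \<noteq> 0" and cop: "coprime p q" and e: "e = of_int p / of_int q"
    by (rule rat_quotient_of_int)
  have e2: "e^2 - 2 * e - 1 = of_int (p^2 - 2*p*q - q^2) / of_int (q^2)"
    unfolding e using q by (simp add: field_simps power2_eq_square)
  define m where "m = p^2 - 2*p*q - q^2"
  define Q P :: rat where "Q = of_int q" and "P = of_int p"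
  have Q: "Q \<noteq> 0" using q by (simp add: Q_def)
  have "of_nat t0 * (of_int m)^2 = of_nat t0 * (of_int m / Q^2)^2 * Q^4"
    using Q by (simp add: power_divide power_mult[symmetric])
  also have "\<dots> = (8 * (P / Q) + 4) * Q^4"
    using h unfolding e2 unfolding e by (simp add: m_def Q_def P_def)
  also have "\<dots> = ((8 * (P / Q) + 4) * Q) * Q^3" by algebra
  also have "(8 * (P / Q) + 4) * Q = 8 * P + 4 * Q" using Q by (simp add: distrib_right)
  also have "(8 * P + 4 * Q) * Q^3 = 4 * Q^3 * (2 * P + Q)" by (simp add: algebra_simps)
  finally have "of_nat t0 * (of_int (p^2 - 2*p*q - q^2))^2 = (of_int (4 * q^3 * (2*p + q)) :: rat)"
    by (simp add: m_def Q_def P_def)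
  hence "of_int (int t0 * (p^2 - 2*p*q - q^2)^2) = (of_int (4 * q^3 * (2*p + q)) :: rat)" by simp
  hence eq: "int t0 * (p^2 - 2*p*q - q^2)^2 = 4 * q^3 * (2*p + q)" by (simp only: of_int_eq_iff)
  have t4: "int t0 mod 4 = 1" using assms by presburger
  hence oddt: "odd (int t0)" by presburger
  have "even (int t0 * (p^2 - 2*p*q - q^2)^2)" unfolding eq by simp
  hence "even (p^2 - q^2)" using oddt by auto
  hence "even p = even q" by auto
  moreover have "\<not> (even p \<and> even q)" using cop by (meson coprime_common_divisor odd_one)
  ultimately obtain a b where p: "p = 2 * a + 1" and q': "q = 2 * b + 1"
    by (metis oddE)
  obtain c where t: "int t0 = 4 * c + 1" using t4 by (metis mod_mult_div_eq add.commute)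
  define w where "w = 2 * (a^2 + a - b^2 - b) - (4*a*b + 2*a + 2*b + 1)"
  have w: "p^2 - 2*p*q - q^2 = 2 * w"
    unfolding p q' w_def by (simp add: algebra_simps power2_eq_square)
  have "4 * (int t0 * w^2) = 4 * (q^3 * (2*p + q))" using eq unfolding w by (simp add: power2_eq_square)
  hence eq2: "int t0 * w^2 = q^3 * (2*p + q)" by simp
  have "odd w" unfolding w_def by simp
  then obtain d where d: "w = 2 * d + 1" by (rule oddE)
  have "(q^3 * (2*p + q)) mod 4 = 3"
  proof -
    \<comment> \<open>The product of \<open>q^2 = 4 * (b^2 + b) + 1\<close> and
      \<open>q^2 + 2*p*q\<close>, which is 3 modulo 4.\<close>
    have "q^3 * (2*p + q) = 4 * ((b^2 + b) * (4 * (2*a*b + a + 2*b + b^2) + 3) + (2*a*b + a + 2*b + b^2)) + 3"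
      unfolding p q' by (simp add: algebra_simps power2_eq_square power3_eq_cube)
    thus ?thesis by presburger
  qed
  moreover have "(int t0 * w^2) mod 4 = 1"
  proof -
    have "int t0 * w^2 = 4 * (c * w^2 + d^2 + d) + 1"
      unfolding t d by (simp add: algebra_simps power2_eq_square)
    thus ?thesis by presburger
  qed
  ultimately show False using eq2 by simp
qed

lemma quartic_zero_pos:
  fixes e :: rat and t0 :: nat
  assumes "t0 \<ge> 5"
  shows "of_nat t0 * (1 + e^2)^2 - 8 * e > 0"
proof -
  define z where "z = 1 + e^2"
  have z: "z \<ge> 1" "2 * e \<le> z" using zero_le_power2[of "e - 1"]
    by (simp_all add: z_def power2_eq_square algebra_simps)
  have "8 * e < 5 * z" using z by linarith
  also have "\<dots> \<le> of_nat t0 * z^2" unfolding power2_eq_square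
    using assms z by (intro mult_mono) auto
  finally show ?thesis by (simp add: z_def)
qed

text \<open>Below \<open>1/2\<close> the linear part \<open>4 - 8 * e\<close> is positive; from
  there on the square dominates it.\<close>

lemma quartic_minus_one_pos:
  fixes e :: rat and t0 :: nat
  assumes "t0 \<ge> 5"
  shows "of_nat t0 * (e^2 + 2 * e - 1)^2 + 4 - 8 * e > 0"
proof -
  have *: "of_nat t0 * (e^2 + 2 * e - 1)^2 \<ge> 5 * (e^2 + 2 * e - 1)^2"
    using assms by (intro mult_right_mono) auto
  show ?thesis
  proof (cases "e < 1/2")
    case True
    have "5 * (e^2 + 2 * e - 1)^2 \<ge> 0" by simp
    thus ?thesis using * True by linarith
  next
    case False
    define z where "z = e - 1/2"
    have z: "z \<ge> 0" using False by (simp add: z_def)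
    have "5 * (e^2 + 2 * e - 1)^2 + 4 - 8 * e = 5 * (z^2 + 3 * z + 1/4)^2 - 8 * z"
      unfolding z_def by (simp add: power2_eq_square algebra_simps)
    \<comment> \<open>The only negative term is \<open>- z/2\<close>; completing the square with
      \<open>45 * z^2\<close> absorbs it and leaves a positive constant.\<close>
    also have "\<dots> = 5 * z^4 + 30 * z^3 + 5/2 * z^2 + 45 * (z - 1/180)^2 + (5/16 - 45/180^2)"
      by (simp add: power2_eq_square algebra_simps power3_eq_cube power4_eq_xxxx)
    also have "\<dots> > 0"
    proof -
      have "z^4 \<ge> 0" "z^3 \<ge> 0" "z^2 \<ge> 0" "(z - 1/180)^2 \<ge> 0" using z by simp_all
      thus ?thesis by (simp add: add_nonneg_pos)
    qed
    finally show ?thesis using * by linarith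
  qed
qed

lemma rat_square_neq_minus_one: "(x :: rat)^2 \<noteq> -1"
proof
  assume "x^2 = -1"
  hence "0 \<le> (-1 :: rat)" by (metis zero_le_power2)
  thus False by simp
qed

lemma rat_square_neq_two: "(x :: rat)^2 \<noteq> 2"
proof
  assume h: "x^2 = 2"
  obtain p q :: int where q: "q \<noteq> 0" and cop: "coprime p q" and e: "x = of_int p / of_int q"
    by (rule rat_quotient_of_int)
  have "of_int (p^2) = (of_int (2 * q^2) :: rat)"
    using h q unfolding e by (simp add: field_simps)
  hence eq: "p^2 = 2 * q^2" by (simp only: of_int_eq_iff)
  hence "even p" by (metis dvd_triv_left even_power pos2)
  then obtain r where "p = 2 * r" by (rule evenE)
  with eq have "q^2 = 2 * r^2" by (simp add: power2_eq_square)
  hence "even q" by (metis dvd_triv_left even_power pos2)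
  with \<open>even p\<close> cop show False by (meson coprime_common_divisor odd_one)
qed

text \<open>The relations say \<open>(al + be u + ga u^2)^2 = k (eps - u)\<close> modulo \<open>u^3 - u + s\<close>.  Such a square
  root corresponds to halving the point \<open>(eps t0, t0)\<close>; \<open>e = be / ga\<close> is \<open>1 / t0\<close> times the
  abscissa of the half.\<close>
lemma descent_class_not_square:
  fixes al be ga k eps s :: rat and t0 :: nat
  assumes t0: "t0 > 1" "t0 mod 4 = 1" and s: "s = 1 / of_nat t0"
    and eps: "eps = 0 \<or> eps = 1 \<or> eps = -1" and k: "k \<noteq> 0"
    and e1: "al^2 - 2 * s * be * ga = k * eps"
    and e2: "s * ga^2 - 2 * be * (al + ga) = k"
    and e3: "be^2 + 2 * al * ga + ga^2 = 0"
  shows False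
proof -
  have t5: "t0 \<ge> 5" using t0 by presburger
  define t :: rat where "t = of_nat t0"
  have ts: "t * s = 1" using t5 by (simp add: t_def s)
  have ga: "ga \<noteq> 0" using e2 e3 k by auto
  define e where "e = be / ga"
  have be: "be = e * ga" using ga by (simp add: e_def)
  have al: "al = - ga * (1 + e^2) / 2"
  proof -
    have "ga * (2 * al + ga * (1 + e^2)) = 0"
      using e3 unfolding be by (simp add: algebra_simps power2_eq_square)
    hence "2 * al + ga * (1 + e^2) = 0" using ga by simp
    thus ?thesis by (simp add: algebra_simps)
  qed
  have k': "k = ga^2 * (e^3 - e + s)"
    unfolding e2[symmetric] al be by (simp add: field_simps power2_eq_square power3_eq_cube)
  have "ga^2 * ((1 + e^2)^2 - 8 * s * e) = ga^2 * (4 * eps * (e^3 - e + s))"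
    using e1 unfolding al be k' by (simp add: field_simps power2_eq_square power3_eq_cube)
  hence "(1 + e^2)^2 - 8 * s * e = 4 * eps * (e^3 - e + s)" using ga by simp
  \<comment> \<open>The halving quartic. For \<open>eps = 1\<close> and \<open>eps = -1\<close> the
    terms with factor \<open>t\<close> collect into \<open>t\<close> times a square.\<close>
  hence main: "t * (1 + e^2)^2 - 8 * e = 4 * eps * (t * (e^3 - e) + 1)"
    using ts by algebra
  from eps show False
  proof (elim disjE)
    assume "eps = 0"
    thus False using main quartic_zero_pos[OF t5, of e] by (simp add: t_def)
  next
    assume "eps = 1"
    hence "t * (e^2 - 2 * e - 1)^2 = 8 * e + 4"
      using main by (simp add: algebra_simps power2_eq_square power3_eq_cube)
    thus False using quartic_one_no_rational_root[OF t0(2), of e] by (simp add: t_def)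
  next
    assume "eps = -1"
    hence "t * (e^2 + 2 * e - 1)^2 + 4 - 8 * e = 0"
      using main by (simp add: algebra_simps power2_eq_square power3_eq_cube)
    thus False using quartic_minus_one_pos[OF t5, of e] by (simp add: t_def)
  qed
qed

section \<open>The covering \<open>s = u - u^3\<close>\<close>

text \<open>The indeterminate stands for \<open>s\<close> in the argument of \<open>lift\<close> and for \<open>u\<close> outside of it.\<close>
definition indet :: "rat poly" where "indet = [:0, 1:]"

definition base_param :: "rat poly" where "base_param = [:0, 1, 0, -1:]"

text \<open>The embedding of Q[s] into Q[u]; over its image Q[u] is free with basis 1, u,
  u^2.\<close>

definition lift :: "rat poly \<Rightarrow> rat poly" where "lift p = pcompose p base_param"

lemma base_param_eq: "base_param = indet - indet ^ 3"
  by (simp add: base_param_def indet_def power3_eq_cube)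

lemma poly_indet [simp]: "poly indet x = x"
  by (simp add: indet_def)

lemma poly_base_param [simp]: "poly base_param x = x - x ^ 3"
  by (simp add: base_param_eq)

lemma indet_neq_0 [simp]: "indet \<noteq> 0" and degree_indet [simp]: "degree indet = 1"
  by (simp_all add: indet_def)

lemma base_param_neq_0 [simp]: "base_param \<noteq> 0" and degree_base_param [simp]: "degree base_param = 3"
  by (simp_all add: base_param_def)

lemma lift_simps [simp]:
  "lift (p + q) = lift p + lift q" "lift (p - q) = lift p - lift q" "lift (- p) = - lift p"
  "lift (p * q) = lift p * lift q" "lift (smult c p) = smult c (lift p)" "lift [:c:] = [:c:]"
  "lift 0 = 0" "lift 1 = 1" "lift indet = base_param"
  by (simp_all add: lift_def pcompose_add pcompose_diff pcompose_uminus pcompose_mult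
      pcompose_smult pcompose_1 indet_def pcompose_pCons)

lemma lift_power [simp]: "lift (p ^ n) = lift p ^ n"
  by (induction n) simp_all

lemma lift_numeral [simp]: "lift (numeral n) = numeral n"
  using lift_simps(6)[of "numeral n"] by (simp add: numeral_poly)

lemma poly_lift [simp]: "poly (lift p) x = poly p (x - x ^ 3)"
  by (simp add: lift_def poly_pcompose)

lemma lift_eq_0_iff [simp]: "lift p = 0 \<longleftrightarrow> p = 0"
  by (simp add: lift_def pcompose_eq_0_iff)

lemma degree_lift [simp]: "degree (lift p) = 3 * degree p"
  by (simp add: lift_def degree_pcompose)

text \<open>As \<open>u^3 = u - s\<close>, multiplication by \<open>u\<close> takes the coordinates
  \<open>(al, be, ga)\<close> to \<open>(- s * ga, al + ga, be)\<close>.\<close>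

lemma lift_decomposition: "\<exists>al be ga. S = lift al + indet * lift be + indet^2 * lift ga"
proof (induction S)
  case 0
  show ?case by (intro exI[of _ 0]) simp
next
  case (pCons c S)
  then obtain al be ga where S: "S = lift al + indet * lift be + indet^2 * lift ga" by blast
  have "pCons c S = [:c:] + indet * S" by (simp add: indet_def)
  also have "\<dots> = lift ([:c:] - indet * ga) + indet * lift (al + ga) + indet^2 * lift be"
    unfolding S by (simp add: base_param_eq algebra_simps power2_eq_square power3_eq_cube)
  finally show ?case by blast
qed

lemma degree_add_eq_max:
  fixes p q :: "'a :: comm_monoid_add poly"
  assumes "p = 0 \<or> q = 0 \<or> degree p \<noteq> degree q"
  shows "degree (p + q) = max (degree p) (degree q)"
  using assms by (cases "degree p" "degree q" rule: linorder_cases)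
    (auto simp: degree_add_eq_left degree_add_eq_right)

text \<open>Nonzero summands have degrees in different residue classes modulo 3, so leading terms
  cannot cancel. The zero polynomial has degree 0, whence the case distinctions.\<close>

lemma degree_lift_combination:
  "degree (lift al + indet * lift be + indet^2 * lift ga) =
     max (max (3 * degree al) (if be = 0 then 0 else 3 * degree be + 1))
         (if ga = 0 then 0 else 3 * degree ga + 2)"
proof -
  have b: "degree (indet * lift be) = (if be = 0 then 0 else 3 * degree be + 1)"
    by (simp add: degree_mult_eq)
  have c: "degree (indet^2 * lift ga) = (if ga = 0 then 0 else 3 * degree ga + 2)"
    by (simp add: degree_mult_eq degree_power_eq)
  have ab: "degree (lift al + indet * lift be) = max (3 * degree al) (if be = 0 then 0 else 3 * degree be + 1)"
  proof -
    have "3 * m \<noteq> 3 * n + 1" for m n :: nat by presburger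
    thus ?thesis by (subst degree_add_eq_max) (force simp: b)+
  qed
  have "ga = 0 \<or> max (3 * degree al) (if be = 0 then 0 else 3 * degree be + 1) \<noteq> 3 * degree ga + 2"
  proof -
    have "3 * m \<noteq> 3 * n + 2" "3 * m + 1 \<noteq> 3 * n + 2" for m n :: nat by presburger+
    thus ?thesis by (auto simp: max_def split: if_splits)
  qed
  thus ?thesis by (subst degree_add_eq_max) (auto simp: ab c)
qed

lemma lift_combination_eq_0:
  assumes "lift al + indet * lift be + indet^2 * lift ga = 0"
  shows "al = 0" "be = 0" "ga = 0"
proof -
  have d: "max (max (3 * degree al) (if be = 0 then 0 else 3 * degree be + 1))
         (if ga = 0 then 0 else 3 * degree ga + 2) = 0"
    using degree_lift_combination[of al be ga] unfolding assms by simp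
  show "ga = 0" using d by (auto simp: max_def split: if_splits)
  moreover show "be = 0" using d by (auto simp: max_def split: if_splits)
  ultimately show "al = 0" using assms by simp
qed

lemma lift_combination_unique:
  assumes "lift al + indet * lift be + indet^2 * lift ga = lift al' + indet * lift be' + indet^2 * lift ga'"
  shows "al = al'" "be = be'" "ga = ga'"
proof -
  have "lift (al - al') + indet * lift (be - be') + indet^2 * lift (ga - ga') = 0"
    using assms by (simp add: algebra_simps)
  from lift_combination_eq_0[OF this] show "al = al'" "be = be'" "ga = ga'" by simp_all
qed

text \<open>Reduction by \<open>u^3 = u - s\<close> and \<open>u^4 = u^2 - s * u\<close>. Comparing
  coordinates turns each square condition of the descent into three equations over Q[s].\<close>

lemma lift_combination_square:
  "(lift al + indet * lift be + indet^2 * lift ga)^2 =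
     lift (al^2 - 2 * indet * be * ga) + indet * lift (2 * be * (al + ga) - indet * ga^2)
       + indet^2 * lift (be^2 + 2 * al * ga + ga^2)"
  by (simp add: base_param_eq) algebra

section \<open>2-descent\<close>

lemma prime_dvd_linear_imp_root:
  fixes H :: "rat poly"
  assumes "\<not> is_unit p" "p dvd [:-c, 1:]" "p dvd H"
  shows "poly H c = 0"
proof (rule ccontr)
  assume nz: "poly H c \<noteq> 0"
  have "[:poly H c:] = H - [:-c, 1:] * synthetic_div H c"
    using synthetic_div_correct'[of c H] by (metis add_diff_cancel_left')
  hence "p dvd [:poly H c:]" using assms by (metis dvd_diff dvd_mult2)
  moreover have "is_unit [:poly H c:]" using nz by (simp add: is_unit_const_poly_iff dvd_field_iff)
  ultimately show False using assms(1) dvd_trans by blast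
qed

text \<open>The squarefree part of \<open>H\<close> has only prime factors of
  \<open>base_param\<close>, and the roots \<open>a\<close> and \<open>b\<close> are excluded as
  \<open>H\<close> does not vanish there. So \<open>H\<close> is \<open>c\<close> or
  \<open>c * (u - e)\<close> up to squares, and its square values at \<open>a\<close> and
  \<open>b\<close> settle which.\<close>

lemma square_if_even_multiplicity:
  fixes H :: "rat poly"
  assumes H: "H \<noteq> 0"
    and ev: "\<And>p. prime p \<Longrightarrow> \<not> p dvd base_param \<Longrightarrow> even (multiplicity p H)"
    and split: "base_param = - [:-e, 1:] * [:-a, 1:] * [:-b, 1:]"
    and Ha: "poly H a = ka^2" "ka \<noteq> 0" and Hb: "poly H b = kb^2" "kb \<noteq> 0"
    and nsq: "\<And>r. r^2 \<noteq> (a - e) * (b - e)"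
  shows "\<exists>S. H = S^2"
proof -
  define h where "h = squarefree_part H"
  define q where "q = square_part H"
  have Hq: "H = h * q^2" unfolding h_def q_def by (rule squarefree_decompose)
  have h0: "h \<noteq> 0" unfolding h_def by simp
  have sqf: "squarefree h" unfolding h_def by simp
  have dvde: "p dvd [:-e, 1:]" if p: "prime p" "p dvd h" for p
  proof -
    have nu: "\<not> is_unit p" using p(1) not_prime_unit by blast
    have pH: "p dvd H" using p(2) Hq by simp
    have "multiplicity p h \<noteq> 0" using p h0 nu by (simp add: multiplicity_eq_zero_iff)
    hence "odd (multiplicity p H)"
      using prime_multiplicity_squarefree_part[OF p(1), of H] by (auto simp: h_def split: if_splits)
    hence "p dvd base_param" using ev p(1) by blast
    hence "p dvd [:-e, 1:] * [:-a, 1:] * [:-b, 1:]" unfolding split by (simp only: mult_minus_left dvd_minus_iff)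
    moreover have "\<not> p dvd [:-a, 1:]" using prime_dvd_linear_imp_root[OF nu _ pH, of a] Ha by auto
    moreover have "\<not> p dvd [:-b, 1:]" using prime_dvd_linear_imp_root[OF nu _ pH, of b] Hb by auto
    ultimately show ?thesis using p(1) by (meson prime_dvd_mult_iff)
  qed
  define L where "L = [:-e, 1:]"
  have Lirr: "irreducible L" unfolding L_def by (simp add: irreducible_linear_field_poly)
  have Ldvd: "L dvd k" if k: "k dvd h" "\<not> is_unit k" for k
  proof -
    have "k \<noteq> 0" using k h0 by auto
    then obtain p where p: "prime p" "p dvd k" using k(2) by (metis prime_divisorE)
    have "p dvd L" unfolding L_def using dvde p k(1) dvd_trans by blast
    hence "L dvd p" using irreducibleD'[OF Lirr] p(1) not_prime_unit by blast
    thus ?thesis using p(2) dvd_trans by blast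
  qed
  \<comment> \<open>Every nonunit divisor of \<open>h\<close> is a multiple of \<open>L\<close>, and
    \<open>L^2\<close> cannot divide the squarefree \<open>h\<close>.\<close>
  have "\<exists>c. h = [:c:] \<or> h = [:c:] * L"
  proof (cases "is_unit h")
    case True
    thus ?thesis using is_unit_poly_iff by blast
  next
    case False
    then obtain k where k: "h = L * k" using Ldvd[of h] by (auto elim: dvdE)
    have "is_unit k"
    proof (rule ccontr)
      assume "\<not> is_unit k"
      hence "L dvd k" using Ldvd[of k] k by simp
      hence "L^2 dvd h" unfolding k power2_eq_square by (rule mult_dvd_mono[OF dvd_refl])
      hence "is_unit L" using sqf squarefreeD by blast
      thus False using Lirr by (simp add: irreducible_def)
    qed
    thus ?thesis using k is_unit_poly_iff by (metis mult.commute)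
  qed
  then obtain c where c: "h = [:c:] \<or> h = [:c:] * L" by blast
  have c0: "c \<noteq> 0" using c h0 by auto
  define qa qb where "qa = poly q a" and "qb = poly q b"
  from c show ?thesis
  proof
    assume h: "h = [:c:]"
    have "c * qa^2 = ka^2" using Ha unfolding Hq h by (simp add: qa_def)
    hence "c = (ka / qa)^2" using Ha(2) c0 by (cases "qa = 0") (auto simp: field_simps)
    hence "H = ([:ka / qa:] * q)^2" unfolding Hq h power_mult_distrib
      by (simp add: power2_eq_square)
    thus ?thesis by blast
  next
    assume h: "h = [:c:] * L"
    have a: "c * (a - e) * qa^2 = ka^2" using Ha unfolding Hq h by (simp add: qa_def L_def algebra_simps)
    have b: "c * (b - e) * qb^2 = kb^2" using Hb unfolding Hq h by (simp add: qb_def L_def algebra_simps)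
    have q0: "qa \<noteq> 0" "qb \<noteq> 0" using a b Ha(2) Hb(2) by auto
    \<comment> \<open>The product of the two value equations would make
      \<open>(a - e) * (b - e)\<close> a square.\<close>
    have "(c * qa * qb)^2 * ((a - e) * (b - e)) = (ka * kb)^2"
      unfolding power_mult_distrib a[symmetric] b[symmetric] by (simp add: power2_eq_square algebra_simps)
    hence "(ka * kb / (c * qa * qb))^2 = (a - e) * (b - e)"
      using q0 c0 by (simp add: power_divide field_simps)
    thus ?thesis using nsq by blast
  qed
qed

lemma coprime_lift:
  assumes "coprime A D" "p dvd lift A" "p dvd lift D"
  shows "is_unit p"
proof -
  obtain x y where "x * A + y * D = gcd A D"
    using bezout_coefficients_fst_snd[of A D] by blast
  hence "lift (x * A + y * D) = lift 1" using assms(1) by simp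
  hence "lift x * lift A + lift y * lift D = 1" by simp
  thus ?thesis using assms(2,3) by (metis dvd_add dvd_mult)
qed

section \<open>Even multiplicity of the linear factor away from \<open>base_param\<close>\<close>

lemma prime_not_dvd_pderiv:
  fixes p :: "rat poly"
  assumes "prime p"
  shows "\<not> p dvd pderiv p"
proof
  assume h: "p dvd pderiv p"
  have p: "p \<noteq> 0" "\<not> is_unit p" using assms not_prime_unit by auto
  hence d: "degree p \<noteq> 0" using is_unit_iff_degree by blast
  hence "pderiv p \<noteq> 0" by (simp add: pderiv_eq_0_iff)
  hence "degree p \<le> degree (pderiv p)" using h by (rule dvd_imp_degree_le[rotated])
  thus False using d by (simp add: degree_pderiv)
qed

lemma prime_square_dvdI:
  fixes p b :: "rat poly"
  assumes p: "prime p" and "p dvd b" "p dvd pderiv b"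
  shows "p^2 dvd b"
proof -
  obtain c where b: "b = p * c" using assms(2) by (rule dvdE)
  have "p dvd p * pderiv c + c * pderiv p" using assms(3) unfolding b pderiv_mult .
  hence "p dvd c * pderiv p" by (metis dvd_add_right_iff dvd_triv_left)
  hence "p dvd c" using p prime_not_dvd_pderiv[OF p] by (simp add: prime_dvd_mult_iff)
  thus ?thesis unfolding b power2_eq_square by (rule mult_dvd_mono[OF dvd_refl])
qed

lemma dvd_pderiv_if_square_dvd:
  fixes p b :: "rat poly"
  assumes "p^2 dvd b"
  shows "p dvd pderiv b"
proof -
  obtain c where "b = p^2 * c" using assms by (rule dvdE)
  hence b: "b = p * (p * c)" by (simp add: power2_eq_square)
  show ?thesis unfolding b by (simp add: pderiv_mult)
qed

lemma pderiv_base_param: "pderiv base_param = 1 - 3 * indet^2"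
proof -
  have "1 - 3 * indet^2 = [:1:] - [:3:] * indet^2" by (simp add: numeral_poly)
  thus ?thesis by (simp add: base_param_def indet_def pderiv_pCons power2_eq_square)
qed

text \<open>By the chain rule these derivatives vanish at the ramification points of the covering,
  where \<open>3 * u^2 = 1\<close>.\<close>

lemma pderiv_lift: "pderiv (lift p) = lift (pderiv p) * (1 - 3 * indet^2)"
  by (simp add: lift_def pderiv_pcompose pderiv_base_param)

lemma pderiv_indet [simp]: "pderiv indet = 1"
  by (simp add: indet_def pderiv_pCons)

text \<open>\<open>D^2\<close> times \<open>X - theta\<close>, where \<open>X = A / D^2\<close> and
  \<open>theta = u * s\<close> is a root of \<open>X^3 - s^2 * X + s^4\<close>.\<close>

definition theta_factor :: "rat poly \<Rightarrow> rat poly \<Rightarrow> rat poly" where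
  "theta_factor A D = lift A - indet * base_param * lift D^2"

text \<open>\<open>D^4\<close> times the remaining quadratic factor
  \<open>X^2 + theta * X + theta^2 - s^2\<close> of the cubic.\<close>

definition theta_cofactor :: "rat poly \<Rightarrow> rat poly \<Rightarrow> rat poly" where
  "theta_cofactor A D = lift A^2 + indet * base_param * lift A * lift D^2
     + (indet^2 - 1) * base_param^2 * lift D^4"

lemma theta_factor_combination:
  "theta_factor A D = lift A + indet * lift (- (indet * D^2)) + indet^2 * lift 0"
  by (simp add: theta_factor_def)

lemma theta_factor_neq_0: "D \<noteq> 0 \<Longrightarrow> theta_factor A D \<noteq> 0"
  unfolding theta_factor_combination using lift_combination_eq_0(2)[of A "- (indet * D^2)" 0] by auto

lemma theta_cofactor_neq_0:
  assumes "D \<noteq> 0" shows "theta_cofactor A D \<noteq> 0"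
proof
  assume h: "theta_cofactor A D = 0"
  have "lift (A^2 - indet^2 * D^4) + indet * lift (indet * A * D^2) + indet^2 * lift (indet^2 * D^4) = 0"
    unfolding h[symmetric] by (simp add: theta_cofactor_def algebra_simps)
  from lift_combination_eq_0(3)[OF this] have "indet^2 * D^4 = 0" .
  thus False using assms by simp
qed

lemma theta_factor_mult_cofactor:
  assumes "B^2 = A^3 - indet^2 * A * D^4 + indet^4 * D^6"
  shows "theta_factor A D * theta_cofactor A D = lift B^2"
proof -
  have "lift (B^2) = lift (A^3 - indet^2 * A * D^4 + indet^4 * D^6)" using assms by simp
  hence b: "lift B^2 = lift A^3 - base_param^2 * lift A * lift D^4 + base_param^4 * lift D^6" by simp
  have "(a - u * s * d^2) * (a^2 + u * s * a * d^2 + (u^2 - 1) * s^2 * d^4)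
      = a^3 - s^2 * a * d^4 + s^4 * d^6" if "s = u - u^3" for a u s d :: "rat poly"
    using that by algebra
  from this[OF base_param_eq] show ?thesis
    unfolding theta_factor_def theta_cofactor_def b by blast
qed

text \<open>A common prime divisor \<open>p\<close> would divide \<open>1 - 3 u^2\<close>, the derivative of \<open>base_param\<close>.  Then \<open>p\<close> is
  ramified, so \<open>p^2\<close> divides \<open>lift B\<close> and \<open>p^4\<close> the product of the two factors, but their
  derivatives modulo \<open>p\<close> show that \<open>p\<close> divides each of them only once.\<close>
lemma theta_factor_cofactor_coprime:
  assumes cop: "coprime A D" and eq: "B^2 = A^3 - indet^2 * A * D^4 + indet^4 * D^6"
    and p: "prime p" "\<not> p dvd base_param" and F: "p dvd theta_factor A D"
  shows "\<not> p dvd theta_cofactor A D"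
proof
  assume G: "p dvd theta_cofactor A D"
  define a d s u where "a = lift A" and "d = lift D" and "s = base_param" and "u = indet"
  define f g where "f = theta_factor A D" and "g = theta_cofactor A D"
  note [simp] = prime_dvd_mult_iff[OF p(1)] prime_dvd_power_iff[OF p(1)]
  have f: "f = a - u * s * d^2" and g: "g = a^2 + u * s * a * d^2 + (u^2 - 1) * s^2 * d^4"
    by (simp_all add: f_def g_def theta_factor_def theta_cofactor_def a_def d_def s_def u_def)
  have pf: "p dvd f" and pg: "p dvd g" using F G by (simp_all add: f_def g_def)
  have nu: "\<not> is_unit p" using p(1) not_prime_unit by blast
  have ps: "\<not> p dvd s" using p(2) by (simp add: s_def)
  have pd: "\<not> p dvd d"
  proof
    assume pd: "p dvd d"
    have "p dvd f + u * s * d^2" using pf pd by (intro dvd_add) simp_all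
    hence "p dvd a" by (simp add: f)
    thus False using coprime_lift[OF cop] pd nu by (simp add: a_def d_def)
  qed
  define tau where "tau = 1 - 3 * u^2"
  \<comment> \<open>At \<open>X = theta\<close> the quadratic factor equals the derivative of the
    cubic, \<open>3 * theta^2 - s^2 = - s^2 * tau\<close>.\<close>
  have "s^2 * d^4 * tau = f * (a + 2 * u * s * d^2) - g"
    unfolding f g tau_def by algebra
  hence "p dvd s^2 * d^4 * tau" using pf pg by (metis dvd_diff dvd_mult2)
  hence tau: "p dvd tau" using ps pd by simp
  have pu: "\<not> p dvd 3 * u"
  proof
    assume "p dvd 3 * u"
    hence "p dvd tau + 3 * u * u" using tau by (metis dvd_add dvd_mult2)
    thus False using nu by (simp add: tau_def power2_eq_square)
  qed
  have der: "pderiv a = lift (pderiv A) * tau" "pderiv d = lift (pderiv D) * tau"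
    "pderiv s = tau" "pderiv u = 1" "pderiv (lift B) = lift (pderiv B) * tau"
    by (simp_all add: a_def d_def s_def u_def tau_def pderiv_lift pderiv_base_param)
  have fg: "f * g = lift B^2" unfolding f_def g_def by (rule theta_factor_mult_cofactor[OF eq])
  have "p dvd lift B^2" unfolding fg[symmetric] using pf by simp
  hence "p dvd lift B" by simp
  hence "p^2 dvd lift B" using tau by (intro prime_square_dvdI p) (simp_all add: der)
  hence "(p^2)^2 dvd f * g" unfolding fg by (rule dvd_power_same)
  moreover obtain f' where f': "f = p * f'" using pf by (rule dvdE)
  moreover obtain g' where g': "g = p * g'" using pg by (rule dvdE)
  ultimately have "p^2 * p^2 dvd p^2 * (f' * g')" by (simp add: power2_eq_square mult_ac)
  moreover have "p^2 \<noteq> 0" using p(1) by auto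
  ultimately have "p^2 dvd f' * g'" by (simp only: dvd_mult_cancel_left) simp
  hence "p dvd f' * g'" by (rule dvd_trans[rotated]) (simp add: power2_eq_square)
  hence "p dvd f' \<or> p dvd g'" by simp
  thus False
  proof
    assume "p dvd f'"
    hence "p^2 dvd f" unfolding f' power2_eq_square by (rule mult_dvd_mono[OF dvd_refl])
    hence h: "p dvd pderiv f" by (rule dvd_pderiv_if_square_dvd)
    \<comment> \<open>Modulo \<open>tau\<close> the lifted \<open>a\<close> and \<open>d\<close>
      have derivative 0 and \<open>u * s\<close> has derivative \<open>s\<close>, so
      \<open>pderiv f\<close> is \<open>- s * d^2\<close>.\<close>
    have "s * d^2 = tau * (lift (pderiv A) - u * d^2 - 2 * u * s * d * lift (pderiv D)) - pderiv f"
      unfolding f by (simp add: pderiv_mult pderiv_diff der power2_eq_square algebra_simps)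
    hence "p dvd s * d^2" using h tau by (metis dvd_diff dvd_mult2)
    thus False using ps pd by simp
  next
    assume "p dvd g'"
    hence "p^2 dvd g" unfolding g' power2_eq_square by (rule mult_dvd_mono[OF dvd_refl])
    hence h: "p dvd pderiv g" by (rule dvd_pderiv_if_square_dvd)
    define A' D' where "A' = lift (pderiv A)" and "D' = lift (pderiv D)"
    have "pderiv g = 2 * a * (A' * tau) + s * a * d^2 + u * tau * a * d^2 + u * s * (A' * tau) * d^2
        + u * s * a * (2 * d * (D' * tau)) + 2 * u * s^2 * d^4 + (u^2 - 1) * (2 * s * tau) * d^4
        + (u^2 - 1) * s^2 * (4 * d^3 * (D' * tau))"
      unfolding g by (simp add: pderiv_mult pderiv_diff pderiv_add der A'_def[symmetric] D'_def[symmetric]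
          power2_eq_square power3_eq_cube power4_eq_xxxx) algebra
    \<comment> \<open>Modulo \<open>tau\<close>, \<open>pderiv g\<close> is
      \<open>s * a * d^2 + 2 * u * s^2 * d^4\<close>; modulo \<open>f\<close>, \<open>a\<close> is
      \<open>u * s * d^2\<close>.\<close>
    hence "3 * u * (s^2 * d^4) = pderiv g - tau * (2 * a * A' + u * a * d^2 + u * s * A' * d^2
        + 2 * u * s * a * d * D' + (u^2 - 1) * (2 * s) * d^4 + (u^2 - 1) * s^2 * 4 * d^3 * D') - f * (s * d^2)"
      unfolding f by algebra
    hence "p dvd 3 * u * (s^2 * d^4)" using h tau pf by (metis dvd_diff dvd_mult2)
    hence "p dvd 3 * u \<or> p dvd s \<or> p dvd d" by simp
    thus False using ps pd pu by simp
  qed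
qed

text \<open>If \<open>p\<close> divides the factor it misses the cofactor, so it occurs exactly as
  often as in the square \<open>lift B^2\<close>.\<close>

lemma even_multiplicity_theta_factor:
  assumes D: "D \<noteq> 0" and cop: "coprime A D" and eq: "B^2 = A^3 - indet^2 * A * D^4 + indet^4 * D^6"
    and p: "prime p" "\<not> p dvd base_param"
  shows "even (multiplicity p (theta_factor A D))"
proof (cases "p dvd theta_factor A D")
  case False
  thus ?thesis by (simp add: not_dvd_imp_multiplicity_0)
next
  case True
  have pe: "prime_elem p" using p by simp
  have "\<not> p dvd theta_cofactor A D" by (rule theta_factor_cofactor_coprime[OF cop eq p True])
  hence m0: "multiplicity p (theta_cofactor A D) = 0" by (simp add: not_dvd_imp_multiplicity_0)
  note fg = theta_factor_mult_cofactor[OF eq]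
  have "lift B \<noteq> 0" using fg theta_factor_neq_0[OF D] theta_cofactor_neq_0[OF D] by (metis mult_eq_0_iff power_zero_numeral)
  hence "multiplicity p (lift B^2) = 2 * multiplicity p (lift B)"
    using pe by (rule prime_elem_multiplicity_power_distrib[rotated])
  moreover have "multiplicity p (lift B^2) = multiplicity p (theta_factor A D) + 0"
    unfolding fg[symmetric] m0[symmetric]
    by (rule prime_elem_multiplicity_mult_distrib[OF pe theta_factor_neq_0[OF D] theta_cofactor_neq_0[OF D]])
  ultimately show ?thesis by simp
qed

section \<open>Points in lowest terms and their descent classes\<close>

text \<open>For reduced fractions \<open>N' / M'\<close> and \<open>R' / T'\<close> the equation
  makes \<open>M'^3\<close> and \<open>T'^2\<close> associated, so \<open>M'\<close> is a square up
  to a unit. The degree bounds serve the descent.\<close>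

lemma reduced_point:
  fixes N M R T :: "rat poly"
  assumes M: "M \<noteq> 0" and T: "T \<noteq> 0"
    and eq: "R^2 * M^3 = T^2 * (N^3 - indet^2 * N * M^2 + indet^4 * M^3)"
  obtains A B D where "coprime A D" "D \<noteq> 0" "B^2 = A^3 - indet^2 * A * D^4 + indet^4 * D^6"
    "A * M = N * D^2" "degree A \<le> degree N" "2 * degree D \<le> degree M"
proof -
  define g where "g = gcd N M"
  define h where "h = gcd R T"
  have g0: "g \<noteq> 0" and h0: "h \<noteq> 0" using M T by (simp_all add: g_def h_def)
  obtain N' M' where N': "N = N' * g" and M': "M = M' * g" and cNM: "coprime N' M'"
    using gcd_coprime_exists[of N M] g0 unfolding g_def by blast
  obtain R' T' where R': "R = R' * h" and T': "T = T' * h" and cRT: "coprime R' T'"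
    using gcd_coprime_exists[of R T] h0 unfolding h_def by blast
  have M'0: "M' \<noteq> 0" and T'0: "T' \<noteq> 0" using M T M' T' by auto
  define K where "K = N'^3 - indet^2 * N' * M'^2 + indet^4 * M'^3"
  have "(h^2 * g^3) * (R'^2 * M'^3) = (h^2 * g^3) * (T'^2 * K)"
    using eq unfolding N' M' R' T' K_def by algebra
  hence eq': "R'^2 * M'^3 = T'^2 * K" using g0 h0 by simp
  have "T'^2 dvd R'^2 * M'^3" unfolding eq' by simp
  hence d1: "T'^2 dvd M'^3" using cRT by (simp add: coprime_dvd_mult_right_iff coprime_commute)
  have "coprime M' K"
  proof (rule coprimeI)
    fix c assume c: "c dvd M'" "c dvd K"
    have "N'^3 = K - M' * (indet^4 * M'^2 - indet^2 * N' * M')" unfolding K_def by algebra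
    hence "c dvd N'^3" using c by (metis dvd_diff dvd_mult2)
    moreover have "coprime (N'^3) M'" using cNM by simp
    ultimately show "is_unit c" using c(1) coprime_common_divisor by blast
  qed
  hence "coprime (M'^3) K" by simp
  moreover have "M'^3 dvd T'^2 * K" unfolding eq'[symmetric] by simp
  ultimately have d2: "M'^3 dvd T'^2" by (simp add: coprime_dvd_mult_left_iff)
  obtain k where k: "M'^3 = T'^2 * k" using d1 by (rule dvdE)
  have "T'^2 * k dvd T'^2 * 1" using d2 k by simp
  moreover have "T'^2 \<noteq> 0" using T'0 by simp
  ultimately have ku: "is_unit k" using dvd_times_left_cancel_iff by blast
  have k0: "k \<noteq> 0" using ku by auto
  have kdeg: "degree k = 0" using ku is_unit_iff_degree[OF k0] by simp
  have "(M'^2)^2 = T'^2 * (k * M')" using k by algebra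
  hence "T'^2 dvd (M'^2)^2" by simp
  hence "T' dvd M'^2" by (subst (asm) pow_divides_pow_iff) simp_all
  then obtain D where D: "M'^2 = T' * D" by (rule dvdE)
  have "T'^2 * D^2 = T'^2 * (k * M')" using D k by algebra
  hence D2: "D^2 = k * M'" using T'0 by simp
  have D0: "D \<noteq> 0" using D2 k0 M'0 by auto
  have "T'^2 * (k * R'^2) = T'^2 * K" using eq' k by algebra
  hence kR: "k * R'^2 = K" using T'0 by simp
  show ?thesis
  \<comment> \<open>The unit \<open>k\<close> enters because \<open>D^2 = k * M'\<close> and
    \<open>D^3 = k^2 * T'\<close>.\<close>
  proof (rule that[of "k * N'" D "k^2 * R'"])
    have "coprime N' (D^2)" unfolding D2 using cNM ku by (simp add: coprime_mult_right_iff is_unit_left_imp_coprime is_unit_right_imp_coprime)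
    thus "coprime (k * N') D" using ku by (simp add: is_unit_left_imp_coprime)
    have "D^4 = (k * M')^2" "D^6 = (k * M')^3" unfolding D2[symmetric] by (simp_all add: power_mult[symmetric])
    thus "(k^2 * R')^2 = (k * N')^3 - indet^2 * (k * N') * D^4 + indet^4 * D^6"
      using kR unfolding K_def by algebra
    show "k * N' * M = N * D^2" unfolding D2 N' M' by simp
    show "degree (k * N') \<le> degree N" using g0 k0 kdeg by (cases "N' = 0") (simp_all add: N' degree_mult_eq)
    have "2 * degree D = degree M'" using arg_cong[OF D2, of degree] D0 k0 M'0 kdeg by (simp add: degree_power_eq degree_mult_eq)
    thus "2 * degree D \<le> degree M" using M'0 g0 by (simp add: M' degree_mult_eq)
  qed (fact D0)
qed

text \<open>The trivial class. At \<open>u = 0, 1, -1\<close> the parameter \<open>s\<close>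
  vanishes, so the factor takes the value \<open>poly A 0\<close>, which is a square because its
  cube is one.\<close>

lemma theta_factor_square:
  assumes D: "D \<noteq> 0" and cop: "coprime A D" and eq: "B^2 = A^3 - indet^2 * A * D^4 + indet^4 * D^6"
    and A0: "poly A 0 \<noteq> 0"
  shows "\<exists>S. theta_factor A D = S^2"
proof -
  have "poly (B^2) 0 = poly (A^3 - indet^2 * A * D^4 + indet^4 * D^6) 0" using eq by simp
  hence AB: "(poly B 0)^2 = (poly A 0)^3" by simp
  define k where "k = poly B 0 / poly A 0"
  have k: "k^2 = poly A 0" unfolding k_def power_divide AB using A0 by (simp add: power2_eq_square power3_eq_cube)
  have k0: "k \<noteq> 0" using k A0 by auto
  show ?thesis
  proof (rule square_if_even_multiplicity[where e = 0 and a = 1 and b = "-1" and ka = k and kb = k])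
    show "theta_factor A D \<noteq> 0" by (rule theta_factor_neq_0[OF D])
    show "even (multiplicity p (theta_factor A D))" if "prime p" "\<not> p dvd base_param" for p
      by (rule even_multiplicity_theta_factor[OF D cop eq that])
    show "base_param = - [:-0, 1:] * [:-1, 1:] * [:- (-1), 1:]" by (simp add: base_param_def)
    show "r^2 \<noteq> (1 - 0) * (- 1 - 0)" for r :: rat
      using rat_square_neq_minus_one[of r] by simp
  qed (simp_all add: theta_factor_def k k0)
qed

text \<open>The classes \<open>s * (e - u)\<close>. Comparing powers of \<open>s\<close> in the
  curve equation gives \<open>A = s * A1\<close> and \<open>A1(0) = e * D(0)^2\<close>; then
  \<open>theta_factor A D\<close> times \<open>(e - u) / s\<close> is shown to be a square.\<close>

lemma twisted_theta_factor_square: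
  assumes D: "D \<noteq> 0" and cop: "coprime A D" and eq: "B^2 = A^3 - indet^2 * A * D^4 + indet^4 * D^6"
    and A0: "poly A 0 = 0"
  obtains A1 e S where "A = indet * A1" "e = 0 \<or> e = 1 \<or> e = -1"
    "([:e:] - indet) * (lift A1 - indet * lift D^2) = S^2"
proof -
  have dvd0: "\<exists>q. p = indet * q" if "poly p 0 = 0" for p
    using that by (auto simp: poly_eq_0_iff_dvd indet_def elim!: dvdE)
  have D0: "poly D 0 \<noteq> 0"
  proof
    assume "poly D 0 = 0"
    hence "[:0, 1:] dvd D" "[:0, 1:] dvd A" using A0 by (simp_all add: poly_eq_0_iff_dvd)
    hence "is_unit ([:0, 1:] :: rat poly)" using cop coprime_common_divisor by blast
    thus False by (simp add: is_unit_iff_degree)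
  qed
  obtain A1 where A1: "A = indet * A1" using dvd0[OF A0] by blast
  have "poly (B^2) 0 = poly (A^3 - indet^2 * A * D^4 + indet^4 * D^6) 0" using eq by simp
  hence "poly B 0 = 0" using A0 by simp
  then obtain B0 where B0: "B = indet * B0" using dvd0 by blast
  have "indet^2 * B0^2 = indet^2 * (indet * (A1^3 - A1 * D^4 + indet * D^6))"
    using eq unfolding A1 B0 by algebra
  hence eq0: "B0^2 = indet * (A1^3 - A1 * D^4 + indet * D^6)" by simp
  hence "poly (B0^2) 0 = poly (indet * (A1^3 - A1 * D^4 + indet * D^6)) 0" by simp
  hence "poly B0 0 = 0" by simp
  then obtain B1 where B1: "B0 = indet * B1" using dvd0 by blast
  have "indet * (indet * B1^2) = indet * (A1^3 - A1 * D^4 + indet * D^6)"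
    using eq0 unfolding B1 by (simp add: power2_eq_square algebra_simps)
  hence "indet * B1^2 = A1^3 - A1 * D^4 + indet * D^6" by simp
  hence "poly (indet * B1^2) 0 = poly (A1^3 - A1 * D^4 + indet * D^6) 0" by simp
  hence *: "(poly A1 0)^3 - poly A1 0 * (poly D 0)^4 = 0" by simp
  define d where "d = poly D 0"
  have "poly A1 0 * (poly A1 0 - d^2) * (poly A1 0 + d^2) = 0"
    using * unfolding d_def[symmetric] by (simp add: algebra_simps power2_eq_square power3_eq_cube power4_eq_xxxx)
  hence "\<exists>e. (e = 0 \<or> e = 1 \<or> e = -1) \<and> poly A1 0 = e * d^2"
    by (auto simp: eq_neg_iff_add_eq_0 intro: exI[of _ "-1"] exI[of _ 0] exI[of _ 1])
  then obtain e where e: "e = 0 \<or> e = 1 \<or> e = -1" and A1e: "poly A1 0 = e * d^2" by blast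
  define H where "H = ([:e:] - indet) * (lift A1 - indet * lift D^2)"
  have FH: "([:e:] - indet) * theta_factor A D = base_param * H"
    unfolding H_def theta_factor_def A1 by (simp add: algebra_simps)
  have en0: "[:e:] - indet \<noteq> 0" by (simp add: indet_def)
  have H0: "H \<noteq> 0" using FH theta_factor_neq_0[OF D, of A] en0 by (metis mult_eq_0_iff)
  \<comment> \<open>At a root \<open>x\<close> of \<open>base_param\<close>, where
    \<open>s = 0\<close>, both factors of \<open>H\<close> contain \<open>e - x\<close>. The value
    is a nonzero square at the two roots other than \<open>e\<close>.\<close>
  have val: "poly H x = ((e - x) * d)^2" if "x^3 = x" for x
    using that by (simp add: H_def A1e d_def[symmetric] power2_eq_square algebra_simps)
  have d0: "d \<noteq> 0" using D0 by (simp add: d_def)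
  have ev: "even (multiplicity p H)" if p: "prime p" "\<not> p dvd base_param" for p
  proof -
    have pe: "prime_elem p" using p by simp
    have "([:e:] - indet) dvd base_param"
    proof -
      have "base_param = ([:e:] - indet) * (indet^2 + [:e:] * indet + [:e^2:] - 1)"
        using e by (auto simp: base_param_def indet_def power2_eq_square one_pCons)
      thus ?thesis by (rule dvdI)
    qed
    hence "\<not> p dvd [:e:] - indet" using p(2) dvd_trans by blast
    hence "multiplicity p (([:e:] - indet) * theta_factor A D) = multiplicity p (theta_factor A D)"
      using prime_elem_multiplicity_mult_distrib[OF pe en0 theta_factor_neq_0[OF D, of A]]
      by (simp add: not_dvd_imp_multiplicity_0)
    moreover have "multiplicity p (base_param * H) = multiplicity p H"
      using prime_elem_multiplicity_mult_distrib[OF pe base_param_neq_0 H0] p(2)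
      by (simp add: not_dvd_imp_multiplicity_0)
    ultimately show ?thesis
      using even_multiplicity_theta_factor[OF D cop eq p] by (simp add: FH)
  qed
  \<comment> \<open>The product of the differences between \<open>e\<close> and the other two roots
    is \<open>-1\<close> or \<open>2\<close>, not a rational square.\<close>
  have "\<exists>S. H = S^2" using e
  proof (elim disjE)
    assume e: "e = 0"
    show ?thesis
    proof (rule square_if_even_multiplicity[where e = 0 and a = 1 and b = "-1", OF H0 ev])
      show "base_param = - [:-0, 1:] * [:-1, 1:] * [:- (-1), 1:]" by (simp add: base_param_def)
      show "r^2 \<noteq> (1 - 0) * (- 1 - 0)" for r :: rat
        using rat_square_neq_minus_one[of r] by simp
      show "poly H 1 = ((e - 1) * d)^2" "poly H (-1) = ((e - (-1)) * d)^2" by (rule val; simp)+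
    qed (use d0 e in simp_all)
  next
    assume e: "e = 1"
    show ?thesis
    proof (rule square_if_even_multiplicity[where e = 1 and a = 0 and b = "-1", OF H0 ev])
      show "base_param = - [:-1, 1:] * [:-0, 1:] * [:- (-1), 1:]" by (simp add: base_param_def)
      show "r^2 \<noteq> (0 - 1) * (- 1 - 1)" for r :: rat
        using rat_square_neq_two[of r] by simp
      show "poly H 0 = ((e - 0) * d)^2" "poly H (-1) = ((e - (-1)) * d)^2" by (rule val; simp)+
    qed (use d0 e in simp_all)
  next
    assume e: "e = -1"
    show ?thesis
    proof (rule square_if_even_multiplicity[where e = "-1" and a = 0 and b = 1, OF H0 ev])
      show "base_param = - [:- (-1), 1:] * [:-0, 1:] * [:-1, 1:]" by (simp add: base_param_def)
      show "r^2 \<noteq> (0 - (-1)) * (1 - (-1))" for r :: rat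
        using rat_square_neq_two[of r] by simp
      show "poly H 0 = ((e - 0) * d)^2" "poly H 1 = ((e - 1) * d)^2" by (rule val; simp)+
    qed (use d0 e in simp_all)
  qed
  then obtain S where "H = S^2" by blast
  thus ?thesis using that A1 e unfolding H_def by blast
qed

section \<open>Infinite descent\<close>

text \<open>Vanishing of \<open>D\<close> at \<open>s0\<close> says that the point reduces to
  infinity there. The descent measure is the degree of \<open>theta_factor A D\<close>.\<close>

lemma no_integral_kernel_point:
  fixes t0 :: nat and s0 :: rat
  assumes t0: "t0 > 1" "t0 mod 4 = 1" and s0: "s0 = 1 / of_nat t0"
    and "coprime A D" "D \<noteq> 0" "B^2 = A^3 - indet^2 * A * D^4 + indet^4 * D^6" "poly D s0 = 0"
  shows False
  using assms(4-)
proof (induction "max (3 * degree A) (6 * degree D + 4)" arbitrary: A B D rule: less_induct)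
  case less
  note cop = less.prems(1) and D = less.prems(2) and eq = less.prems(3) and Ds = less.prems(4)
  have odd: "odd t0" using t0(2) by presburger
  have s00: "s0 \<noteq> 0" using t0 by (simp add: s0)
  have As: "poly A s0 \<noteq> 0"
  proof
    assume "poly A s0 = 0"
    hence "[:- s0, 1:] dvd D" "[:- s0, 1:] dvd A" using Ds by (simp_all add: poly_eq_0_iff_dvd)
    hence "is_unit [:- s0, 1:]" using cop coprime_common_divisor by blast
    thus False by (simp add: is_unit_iff_degree)
  qed
  show False
  proof (cases "poly A 0 = 0")
    case True
    then obtain A1 e S where A1: "A = indet * A1" and e: "e = 0 \<or> e = 1 \<or> e = -1"
      and S: "([:e:] - indet) * (lift A1 - indet * lift D^2) = S^2"
      using twisted_theta_factor_square[OF D cop eq] by metis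
    obtain al be ga where SS: "S = lift al + indet * lift be + indet^2 * lift ga"
      using lift_decomposition by blast
    have "lift ([:e:] * A1) + indet * lift (- A1 - [:e:] * D^2) + indet^2 * lift (D^2)
      = lift (al^2 - 2 * indet * be * ga) + indet * lift (2 * be * (al + ga) - indet * ga^2)
       + indet^2 * lift (be^2 + 2 * al * ga + ga^2)"
      unfolding lift_combination_square[symmetric] SS[symmetric] S[symmetric]
      by (simp add: algebra_simps power2_eq_square)
    note c = lift_combination_unique[OF this]
    have c1: "poly ([:e:] * A1) s0 = poly (al^2 - 2 * indet * be * ga) s0"
     and c2: "poly (- A1 - [:e:] * D^2) s0 = poly (2 * be * (al + ga) - indet * ga^2) s0"
     and c3: "poly (D^2) s0 = poly (be^2 + 2 * al * ga + ga^2) s0"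
      using c by simp_all
    show False
    \<comment> \<open>As \<open>D\<close> vanishes at \<open>s0\<close>, the square
      \<open>S^2\<close> becomes \<open>k * (e - u)\<close> with
      \<open>k = poly A1 s0\<close>.\<close>
    proof (rule descent_class_not_square[OF t0 s0 e])
      show "poly A1 s0 \<noteq> 0" using As A1 by auto
      show "(poly al s0)^2 - 2 * s0 * poly be s0 * poly ga s0 = poly A1 s0 * e"
        using c1 by (simp add: mult.commute)
      show "s0 * (poly ga s0)^2 - 2 * poly be s0 * (poly al s0 + poly ga s0) = poly A1 s0"
        using c2 Ds by (simp add: algebra_simps)
      show "(poly be s0)^2 + 2 * poly al s0 * poly ga s0 + (poly ga s0)^2 = 0"
        using c3 Ds by simp
    qed
  next
    case False
    then obtain S where S: "theta_factor A D = S^2" using theta_factor_square[OF D cop eq] by blast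
    obtain al be ga where SS: "S = lift al + indet * lift be + indet^2 * lift ga"
      using lift_decomposition by blast
    have "lift A + indet * lift (- (indet * D^2)) + indet^2 * lift 0
      = lift (al^2 - 2 * indet * be * ga) + indet * lift (2 * be * (al + ga) - indet * ga^2)
       + indet^2 * lift (be^2 + 2 * al * ga + ga^2)"
      unfolding lift_combination_square[symmetric] SS[symmetric] S[symmetric]
      by (rule theta_factor_combination[symmetric])
    note c = lift_combination_unique[OF this]
    have c2: "indet * D^2 = indet * ga^2 - 2 * be * (al + ga)" using c(2) by algebra
    have c3: "be^2 = - ga * (2 * al + ga)" using c(3) by algebra
    have ga0: "ga \<noteq> 0" using c2 c3 D by auto
    define a b g where "a = poly al s0" and "b = poly be s0" and "g = poly ga s0"
    have "poly (indet * D^2) s0 = poly (indet * ga^2 - 2 * be * (al + ga)) s0" using c2 by simp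
    hence p2: "s0 * g^2 - 2 * b * (a + g) = 0" using Ds by (simp add: a_def b_def g_def)
    have "poly (be^2) s0 = poly (- ga * (2 * al + ga)) s0" using c3 by simp
    hence p3: "b^2 = - g * (2 * a + g)" by (simp add: a_def b_def g_def)
    have "poly A s0 = poly (al^2 - 2 * indet * be * ga) s0" using c(1) by simp
    hence p1: "poly A s0 = a^2 - 2 * s0 * b * g" by (simp add: a_def b_def g_def)
    \<comment> \<open>Otherwise \<open>b / g\<close> would be a root of the cubic: the half of the
      point would reduce to a point of order 2.\<close>
    have g0: "g = 0"
    proof (rule ccontr)
      assume g: "g \<noteq> 0"
      define r where "r = b / g"
      have b: "b = r * g" using g by (simp add: r_def)
      have "g^3 * (r^3 - r + s0) = 0" using p2 p3 unfolding b by algebra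
      thus False using g cubic_no_rational_root[OF odd, of r] by (simp add: s0)
    qed
    have b0: "b = 0" using p3 g0 by simp
    have a0: "a \<noteq> 0" using p1 g0 As by auto
    have nz: "poly (2 * al + ga) s0 \<noteq> 0" using a0 g0 by (simp add: a_def g_def)
    hence nz': "2 * al + ga \<noteq> 0" by (metis poly_0)
    hence be0: "be \<noteq> 0" using c3 ga0 by auto
    \<comment> \<open>Since \<open>2 * al + ga\<close> does not vanish at \<open>s0\<close>,
      \<open>ga\<close> vanishes there twice as often as \<open>be\<close>, so
      \<open>be / ga\<close> has a pole.\<close>
    have "order s0 (be^2) = order s0 (ga * (2 * al + ga))" unfolding c3 by simp
    hence ord: "2 * order s0 be = order s0 ga"
      using be0 ga0 nz nz' by (subst (asm) order_mult) (auto simp: power2_eq_square order_mult order_0I)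
    have ordb: "order s0 be > 0" using be0 b0 by (simp add: order_gt_0_iff b_def)
    \<comment> \<open>The half of the given point is \<open>(s be / ga, s^2 D / ga)\<close>.\<close>
    have pt: "(indet^2 * D)^2 * ga^3 = ga^2 * ((indet * be)^3 - indet^2 * (indet * be) * ga^2 + indet^4 * ga^3)"
      using c2 c3 by algebra
    obtain A' B' D' where new: "coprime A' D'" "D' \<noteq> 0" "B'^2 = A'^3 - indet^2 * A' * D'^4 + indet^4 * D'^6"
      "A' * ga = indet * be * D'^2" "degree A' \<le> degree (indet * be)" "2 * degree D' \<le> degree ga"
      using reduced_point[OF ga0 ga0 pt] by metis
    \<comment> \<open>Otherwise comparing orders at \<open>s0\<close> in
      \<open>A' * ga = indet * be * D'^2\<close> would give
      \<open>2 * order s0 be \<le> order s0 be\<close>.\<close>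
    have D's: "poly D' s0 = 0"
    proof (rule ccontr)
      assume D's: "poly D' s0 \<noteq> 0"
      have rhs0: "indet * be * D'^2 \<noteq> 0" using be0 new(2) by simp
      hence lhs0: "A' * ga \<noteq> 0" using new(4) by simp
      have "order s0 (indet * be * D'^2) = order s0 be"
        using rhs0 D's s00 by (simp add: order_mult power2_eq_square order_0I)
      moreover have "order s0 (A' * ga) = order s0 A' + order s0 ga"
        using lhs0 by (rule order_mult)
      ultimately show False using new(4) ord ordb by simp
    qed
    have dS: "2 * degree S = max (3 * degree A) (6 * degree D + 4)"
    proof -
      have "2 * degree S = degree (theta_factor A D)" unfolding S
        using S theta_factor_neq_0[OF D, of A] by (simp add: degree_power_eq)
      also have "\<dots> = max (3 * degree A) (6 * degree D + 4)"
        unfolding theta_factor_combination degree_lift_combination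
        using D by (simp add: degree_mult_eq degree_power_eq)
      finally show ?thesis .
    qed
    have dS': "3 * degree be + 1 \<le> degree S" "3 * degree ga + 2 \<le> degree S"
      unfolding SS degree_lift_combination using be0 ga0 by simp_all
    have dA': "degree A' \<le> degree be + 1" using new(5) be0 by (simp add: degree_mult_eq)
    have "degree D \<noteq> 0"
    proof
      assume "degree D = 0"
      then obtain c where "D = [:c:]" by (rule degree_eq_zeroE)
      thus False using D Ds by simp
    qed
    \<comment> \<open>Both new terms are at most \<open>degree S + 2\<close>; the old maximum is
      \<open>2 * degree S\<close>, at least 10 because \<open>degree D \<ge> 1\<close>.\<close>
    hence "max (3 * degree A') (6 * degree D' + 4) < max (3 * degree A) (6 * degree D + 4)"
      using dS dS' dA' new(6) by linarith
    thus False using less.hyps new(1-3) D's by blast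
  qed
qed

section \<open>Rational functions and specialization\<close>

lemma poly_eqI_nonzero:
  fixes p q :: "rat poly"
  assumes "\<And>x. x \<noteq> 0 \<Longrightarrow> poly p x = poly q x"
  shows "p = q"
proof (rule ccontr)
  assume "p \<noteq> q"
  hence "finite {x. poly (p - q) x = 0}" by (intro poly_roots_finite) simp
  moreover have "- {0} \<subseteq> {x. poly (p - q) x = 0}" using assms by auto
  ultimately have "finite (- {0 :: rat})" by (rule finite_subset[rotated])
  thus False by (simp add: finite_compl infinite_UNIV_char_0)
qed

text \<open>For \<open>degree p \<le> k\<close> this is \<open>s^k * p(1 / s)\<close>; a common
  \<open>k\<close> rescales all polynomials of an equation alike.\<close>

definition reflect_at :: "nat \<Rightarrow> rat poly \<Rightarrow> rat poly" where
  "reflect_at k p = monom 1 (k - degree p) * reflect_poly p"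

lemma poly_reflect_at:
  assumes "degree p \<le> k" "x \<noteq> 0"
  shows "poly (reflect_at k p) x = x ^ k * poly p (1 / x)"
  using assms by (simp add: reflect_at_def poly_monom poly_reflect_poly_nz divide_inverse
      power_add[symmetric] mult.assoc[symmetric])

lemma reflect_at_neq_0: "p \<noteq> 0 \<Longrightarrow> reflect_at k p \<noteq> 0"
  by (simp add: reflect_at_def)

lemma to_fract_power: "to_fract (p ^ n) = to_fract p ^ n"
  by (induction n) simp_all

section \<open>Values of rational functions\<close>

lemma ratfun_quotient: "f = to_fract (fst (quot_of_fract f)) / to_fract (snd (quot_of_fract f))"
  by (metis Fract_conv_to_fract Fract_quot_of_fract)

text \<open>The denominator in lowest terms divides \<open>q\<close>, so any fraction with
  \<open>q\<close> nonvanishing at \<open>t\<close> may be used.\<close>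

lemma eval_at_quotient:
  assumes f: "f = to_fract p / to_fract q" and q: "poly q t \<noteq> 0"
  shows "\<not> has_pole_at t f" "eval_at t f = poly p t / poly q t"
proof -
  define n m where "n = fst (quot_of_fract f)" and "m = snd (quot_of_fract f)"
  have m0: "m \<noteq> 0" by (simp add: m_def)
  have q0: "q \<noteq> 0" using q by auto
  have "to_fract n / to_fract m = to_fract p / to_fract q"
    using ratfun_quotient[of f] f by (simp add: n_def m_def)
  hence "to_fract (n * q) = to_fract (p * m)" using m0 q0 by (simp add: frac_eq_eq)
  hence eq: "n * q = p * m" by (simp only: to_fract_eq_iff)
  have "coprime n m" unfolding n_def m_def by (rule coprime_quot_of_fract)
  moreover have "m dvd n * q" unfolding eq by simp
  ultimately have "m dvd q" by (simp add: coprime_dvd_mult_right_iff coprime_commute)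
  hence mt: "poly m t \<noteq> 0" using q by (auto elim!: dvdE)
  thus "\<not> has_pole_at t f" by (simp add: has_pole_at_def m_def)
  have "poly (n * q) t = poly (p * m) t" using eq by simp
  thus "eval_at t f = poly p t / poly q t" unfolding eval_at_def n_def[symmetric] m_def[symmetric]
    using mt q by (simp add: frac_eq_eq)
qed

lemma no_poleE:
  assumes "\<not> has_pole_at t f"
  obtains p q where "f = to_fract p / to_fract q" "poly q t \<noteq> 0" "to_fract q \<noteq> 0"
    "eval_at t f = poly p t / poly q t"
  using assms that[OF ratfun_quotient[of f]] by (simp add: has_pole_at_def eval_at_def)

lemma eval_at_add:
  assumes "\<not> has_pole_at t f" "\<not> has_pole_at t g"
  shows "\<not> has_pole_at t (f + g)" "eval_at t (f + g) = eval_at t f + eval_at t g"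
proof -
  obtain p q where f: "f = to_fract p / to_fract q" "poly q t \<noteq> 0" "to_fract q \<noteq> 0"
    "eval_at t f = poly p t / poly q t" using assms(1) by (rule no_poleE)
  obtain p' q' where g: "g = to_fract p' / to_fract q'" "poly q' t \<noteq> 0" "to_fract q' \<noteq> 0"
    "eval_at t g = poly p' t / poly q' t" using assms(2) by (rule no_poleE)
  have s: "f + g = to_fract (p * q' + p' * q) / to_fract (q * q')"
    using f(3) g(3) by (simp add: f(1) g(1) add_frac_eq)
  have "poly (q * q') t \<noteq> 0" using f(2) g(2) by simp
  note e = eval_at_quotient[OF s this]
  show "\<not> has_pole_at t (f + g)" by (rule e(1))
  show "eval_at t (f + g) = eval_at t f + eval_at t g"
    using f(2) g(2) by (simp add: e(2) f(4) g(4) add_frac_eq)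
qed

lemma eval_at_mult:
  assumes "\<not> has_pole_at t f" "\<not> has_pole_at t g"
  shows "\<not> has_pole_at t (f * g)" "eval_at t (f * g) = eval_at t f * eval_at t g"
proof -
  obtain p q where f: "f = to_fract p / to_fract q" "poly q t \<noteq> 0" "to_fract q \<noteq> 0"
    "eval_at t f = poly p t / poly q t" using assms(1) by (rule no_poleE)
  obtain p' q' where g: "g = to_fract p' / to_fract q'" "poly q' t \<noteq> 0" "to_fract q' \<noteq> 0"
    "eval_at t g = poly p' t / poly q' t" using assms(2) by (rule no_poleE)
  have s: "f * g = to_fract (p * p') / to_fract (q * q')"
    by (simp add: f(1) g(1))
  have "poly (q * q') t \<noteq> 0" using f(2) g(2) by simp
  note e = eval_at_quotient[OF s this]
  show "\<not> has_pole_at t (f * g)" by (rule e(1))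
  show "eval_at t (f * g) = eval_at t f * eval_at t g"
    by (simp add: e(2) f(4) g(4))
qed

lemma eval_at_to_fract:
  "\<not> has_pole_at t (to_fract p)" "eval_at t (to_fract p) = poly p t"
  using eval_at_quotient[of "to_fract p" p 1 t] by simp_all

lemma eval_at_uminus:
  assumes "\<not> has_pole_at t f"
  shows "\<not> has_pole_at t (- f)" "eval_at t (- f) = - eval_at t f"
  using eval_at_mult[OF eval_at_to_fract(1)[of t "-1"] assms]
    eval_at_to_fract(2)[of t "-1"] by simp_all

lemma eval_at_diff:
  assumes "\<not> has_pole_at t f" "\<not> has_pole_at t g"
  shows "\<not> has_pole_at t (f - g)" "eval_at t (f - g) = eval_at t f - eval_at t g"
  using eval_at_add[OF assms(1) eval_at_uminus(1)[OF assms(2)]] eval_at_uminus(2)[OF assms(2)]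
  by simp_all

lemma eval_at_power:
  assumes "\<not> has_pole_at t f"
  shows "\<not> has_pole_at t (f ^ n) \<and> eval_at t (f ^ n) = eval_at t f ^ n"
proof (induction n)
  case 0
  show ?case using eval_at_to_fract[of t 1] by simp
next
  case (Suc n)
  thus ?case using eval_at_mult[OF assms, of "f ^ n"] by simp
qed

text \<open>\<open>specialize\<close> tests only the abscissa for poles; through the curve equation
  this lemma covers the ordinate.\<close>

lemma no_pole_if_square_no_pole:
  assumes "\<not> has_pole_at t (y^2)"
  shows "\<not> has_pole_at t y"
proof
  assume pole: "has_pole_at t y"
  define n m where "n = fst (quot_of_fract y)" and "m = snd (quot_of_fract y)"
  have y: "y = to_fract n / to_fract m" unfolding n_def m_def by (rule ratfun_quotient)
  have m0: "m \<noteq> 0" by (simp add: m_def)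
  have mt: "poly m t = 0" using pole by (simp add: has_pole_at_def m_def)
  have cop: "coprime n m" unfolding n_def m_def by (rule coprime_quot_of_fract)
  obtain p q where q: "y^2 = to_fract p / to_fract q" "poly q t \<noteq> 0" "to_fract q \<noteq> 0"
    using assms by (rule no_poleE)
  have "to_fract (n^2 * q) = to_fract (p * m^2)"
    using q(1,3) m0 unfolding y by (simp add: power_divide frac_eq_eq to_fract_power)
  hence "n^2 * q = p * m^2" by (simp only: to_fract_eq_iff)
  hence "poly (n^2 * q) t = poly (p * m^2) t" by simp
  hence "poly n t = 0" using mt q(2) by simp
  hence "[:- t, 1:] dvd n" "[:- t, 1:] dvd m" using mt by (simp_all add: poly_eq_0_iff_dvd)
  hence "is_unit [:- t, 1:]" using cop coprime_common_divisor by blast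
  thus False by (simp add: is_unit_iff_degree)
qed

text \<open>With \<open>s = 1 / t\<close>, \<open>X = s^2 * x\<close> and
  \<open>Y = s^3 * y\<close>, a pole at \<open>t0\<close> becomes a zero of \<open>D\<close> at
  \<open>s0\<close>, which the descent excludes.\<close>

lemma no_pole_of_point:
  fixes t0 :: nat
  assumes t0: "t0 > 1" "t0 mod 4 = 1" and xy: "y^2 = x^3 - tvar^2 * x + tvar^2"
  shows "\<not> has_pole_at (of_nat t0) x"
proof
  assume pole: "has_pole_at (of_nat t0) x"
  define n m where "n = fst (quot_of_fract x)" and "m = snd (quot_of_fract x)"
  define r q where "r = fst (quot_of_fract y)" and "q = snd (quot_of_fract y)"
  have x: "x = to_fract n / to_fract m" unfolding n_def m_def by (rule ratfun_quotient)
  have y: "y = to_fract r / to_fract q" unfolding r_def q_def by (rule ratfun_quotient)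
  have m0: "m \<noteq> 0" and q0: "q \<noteq> 0" by (simp_all add: m_def q_def)
  have cop: "coprime n m" unfolding n_def m_def by (rule coprime_quot_of_fract)
  define s0 :: rat where "s0 = 1 / of_nat t0"
  have s00: "s0 \<noteq> 0" using t0 by (simp add: s0_def)
  have mt: "poly m (1 / s0) = 0" using pole by (simp add: has_pole_at_def m_def s0_def)
  have nt: "poly n (1 / s0) \<noteq> 0"
  proof
    assume "poly n (1 / s0) = 0"
    hence "[:- (1 / s0), 1:] dvd n" "[:- (1 / s0), 1:] dvd m" using mt by (simp_all add: poly_eq_0_iff_dvd)
    hence "is_unit [:- (1 / s0), 1:]" using cop coprime_common_divisor by blast
    thus False by (simp add: is_unit_iff_degree)
  qed
  define N M R Q :: ratfun where "N = to_fract n" and "M = to_fract m" and "R = to_fract r" and "Q = to_fract q"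
  have "M \<noteq> 0" "Q \<noteq> 0" using m0 q0 by (simp_all add: M_def Q_def)
  have yQ: "y * Q = R" and xM: "x * M = N" using \<open>M \<noteq> 0\<close> \<open>Q \<noteq> 0\<close> by (simp_all add: x y N_def M_def R_def Q_def)
  have "R^2 * M^3 = Q^2 * (N^3 - tvar^2 * N * M^2 + tvar^2 * M^3)"
    unfolding yQ[symmetric] xM[symmetric] using xy by algebra
  hence "to_fract (r^2 * m^3) = to_fract (q^2 * (n^3 - indet^2 * n * m^2 + indet^2 * m^3))"
    by (simp add: N_def M_def R_def Q_def tvar_def indet_def to_fract_power)
  hence eq: "r^2 * m^3 = q^2 * (n^3 - indet^2 * n * m^2 + indet^2 * m^3)" by (simp only: to_fract_eq_iff)
  define k where "k = degree n + degree m + degree r + degree q"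
  define n' m' r' q' where "n' = reflect_at k n" and "m' = reflect_at k m"
    and "r' = reflect_at k r" and "q' = reflect_at k q"
  have val: "poly n' s = s^k * poly n (1/s)" "poly m' s = s^k * poly m (1/s)"
    "poly r' s = s^k * poly r (1/s)" "poly q' s = s^k * poly q (1/s)" if "s \<noteq> 0" for s
    unfolding n'_def m'_def r'_def q'_def using that by (simp_all add: poly_reflect_at k_def)
  have m'0: "m' \<noteq> 0" and q'0: "q' \<noteq> 0" using m0 q0 by (simp_all add: m'_def q'_def reflect_at_neq_0)
  have pt: "(indet^3 * r')^2 * m'^3 = q'^2 * ((indet^2 * n')^3 - indet^2 * (indet^2 * n') * m'^2 + indet^4 * m'^3)"
  proof (rule poly_eqI_nonzero)
    fix s :: rat assume s: "s \<noteq> 0"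
    define z where "z = 1 / s"
    have sz: "s * z = 1" using s by (simp add: z_def)
    have "poly (r^2 * m^3) z = poly (q^2 * (n^3 - indet^2 * n * m^2 + indet^2 * m^3)) z" using eq by simp
    hence e: "(poly r z)^2 * (poly m z)^3 = (poly q z)^2 * ((poly n z)^3 - z^2 * poly n z * (poly m z)^2 + z^2 * (poly m z)^3)"
      by simp
    \<comment> \<open>The equation is homogeneous of degree 5 in \<open>r, q, n, m\<close>, so the
      common factor \<open>K = s^k\<close> is harmless; \<open>s * z = 1\<close> removes
      \<open>z\<close>.\<close>
    have gen: "(s^3 * (K * r))^2 * (K * m)^3 = (K * q)^2 * ((s^2 * (K * n))^3 - s^2 * (s^2 * (K * n)) * (K * m)^2 + s^4 * (K * m)^3)"
      if "r^2 * m^3 = q^2 * (n^3 - z^2 * n * m^2 + z^2 * m^3)" for K r q n m :: rat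
    proof -
      have "(s^3 * (K * r))^2 * (K * m)^3 = s^6 * K^5 * (r^2 * m^3)" by algebra
      also have "\<dots> = K^5 * q^2 * (s^6 * n^3 - s^4 * (s * z)^2 * n * m^2 + s^4 * (s * z)^2 * m^3)"
        unfolding that by algebra
      also have "\<dots> = (K * q)^2 * ((s^2 * (K * n))^3 - s^2 * (s^2 * (K * n)) * (K * m)^2 + s^4 * (K * m)^3)"
        unfolding sz power_one mult_1_right by algebra
      finally show ?thesis .
    qed
    show "poly ((indet^3 * r')^2 * m'^3) s = poly (q'^2 * ((indet^2 * n')^3 - indet^2 * (indet^2 * n') * m'^2 + indet^4 * m'^3)) s"
      using gen[OF e, of "s^k"] by (simp add: val[OF s] z_def)
  qed
  obtain A B D where new: "coprime A D" "D \<noteq> 0" "B^2 = A^3 - indet^2 * A * D^4 + indet^4 * D^6"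
    "A * m' = indet^2 * n' * D^2"
    using reduced_point[OF m'0 q'0 pt] by metis
  have "poly (A * m') s0 = poly (indet^2 * n' * D^2) s0" using new(4) by simp
  hence "poly D s0 = 0" using mt nt s00 by (simp add: val[OF s00])
  with no_integral_kernel_point[OF t0 s0_def new(1-3)] show False by blast
qed

section \<open>Injectivity from the difference of two points\<close>

text \<open>The line through \<open>(x1, y1)\<close> and \<open>(x2, - y2)\<close> has slope
  \<open>l\<close>; its third intersection is, up to sign, the difference of the two points.\<close>

lemma chord_third_point:
  fixes x1 x2 y1 y2 a b :: "'a :: field"
  assumes "x1 \<noteq> x2" "y1^2 = x1^3 - a * x1 + b" "y2^2 = x2^3 - a * x2 + b"
  defines "l \<equiv> (y1 + y2) / (x1 - x2)"
  defines "x3 \<equiv> l^2 - x1 - x2"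
  shows "(y1 + l * (x3 - x1))^2 = x3^3 - a * x3 + b"
proof -
  have l: "l * (x1 - x2) = y1 + y2" using assms(1) by (simp add: l_def)
  \<comment> \<open>The cubic minus the squared line differs from
    \<open>(X - x1) * (X - x2) * (X - x3)\<close> by a linear polynomial, interpolated here from
    \<open>x1\<close> and \<open>x2\<close> to \<open>x3\<close>.\<close>
  have "(x1 - x2) * ((x3^3 - a * x3 + b) - (y1 + l * (x3 - x1))^2)
      = (x3 - x2) * ((x1^3 - a * x1 + b) - y1^2) - (x3 - x1) * ((x2^3 - a * x2 + b) - (y1 - l * (x1 - x2))^2)"
    unfolding x3_def by algebra
  also have "\<dots> = 0" unfolding l using assms(2,3) by simp
  finally show ?thesis using assms(1) by simp
qed

theorem theorem4p6:
  fixes t0 :: nat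
  assumes "t0 > 1" and "t0 mod 4 = 1"
  shows "inj_on (specialize (of_nat t0)) E_Qt_points"
proof -
  define t :: rat where "t = of_nat t0"
  have t: "t \<noteq> 0" using assms by (simp add: t_def)
  note reg = no_pole_of_point[OF assms, folded t_def]
  have tv: "\<not> has_pole_at t tvar" "eval_at t tvar = t"
    by (simp_all add: tvar_def eval_at_to_fract)
  have curve: "\<not> has_pole_at t y \<and> (eval_at t y)^2 = (eval_at t x)^3 - t^2 * eval_at t x + t^2"
    if xy: "y^2 = x^3 - tvar^2 * x + tvar^2" for x y
  proof -
    note x = reg[OF xy]
    note r = eval_at_power[OF x, of 3] eval_at_power[OF tv(1), of 2]
    have r2: "\<not> has_pole_at t (tvar^2 * x)" "eval_at t (tvar^2 * x) = t^2 * eval_at t x"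
      using eval_at_mult[of t "tvar^2" x] r x tv by simp_all
    have r3: "\<not> has_pole_at t (x^3 - tvar^2 * x)" "eval_at t (x^3 - tvar^2 * x) = (eval_at t x)^3 - t^2 * eval_at t x"
      using eval_at_diff[of t "x^3" "tvar^2 * x"] r r2 by simp_all
    have r4: "\<not> has_pole_at t (y^2)" "eval_at t (y^2) = (eval_at t x)^3 - t^2 * eval_at t x + t^2"
      unfolding xy using eval_at_add[of t "x^3 - tvar^2 * x" "tvar^2"] r r3 tv by simp_all
    have "\<not> has_pole_at t y" by (rule no_pole_if_square_no_pole[OF r4(1)])
    thus ?thesis using eval_at_power[of t y 2] r4(2) by simp
  qed
  \<comment> \<open>A zero would give a rational point of order 2 on the specialized curve.\<close>
  have y0: "eval_at t y \<noteq> 0" if xy: "y^2 = x^3 - tvar^2 * x + tvar^2" for x y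
  proof
    assume "eval_at t y = 0"
    hence e: "(eval_at t x)^3 - t^2 * eval_at t x + t^2 = 0" using curve[OF xy] by simp
    define v where "v = eval_at t x / t"
    have x: "eval_at t x = t * v" using t by (simp add: v_def)
    have "t^3 * (v^3 - v + 1 / t) = 0"
      using e t unfolding x by (simp add: power2_eq_square power3_eq_cube algebra_simps)
    moreover have "odd t0" using assms(2) by presburger
    ultimately show False using cubic_no_rational_root[of t0 v] t by (simp add: t_def)
  qed
  have "P = Q" if P: "P \<in> E_Qt_points" and Q: "Q \<in> E_Qt_points" and s: "specialize t P = specialize t Q" for P Q
  proof (cases P)
    case None
    thus ?thesis using P Q s reg by (auto simp: E_Qt_points_def specialize_def split: if_splits)
  next
    case (Some p)
    then obtain x1 y1 where P1: "P = Some (x1, y1)" by (cases p) auto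
    have e1: "y1^2 = x1^3 - tvar^2 * x1 + tvar^2" using P P1 by (simp add: E_Qt_points_def)
    have "Q \<noteq> None" using s P1 reg[OF e1] by (cases Q) (auto simp: specialize_def)
    then obtain x2 y2 where Q2: "Q = Some (x2, y2)" by (metis not_None_eq surj_pair)
    have e2: "y2^2 = x2^3 - tvar^2 * x2 + tvar^2" using Q Q2 by (simp add: E_Qt_points_def)
    note x1 = reg[OF e1] and x2 = reg[OF e2]
    have y1: "\<not> has_pole_at t y1" and y2: "\<not> has_pole_at t y2" using curve[OF e1] curve[OF e2] by simp_all
    have ev: "eval_at t x1 = eval_at t x2" "eval_at t y1 = eval_at t y2"
      using s x1 x2 by (simp_all add: P1 Q2 specialize_def)
    have ysum: "\<not> has_pole_at t (y1 + y2)" "eval_at t (y1 + y2) = 2 * eval_at t y1"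
      using eval_at_add[OF y1 y2] ev by simp_all
    show ?thesis
    proof (cases "x1 = x2")
      case True
      hence "y1^2 = y2^2" using e1 e2 by simp
      hence "y1 = y2 \<or> y1 + y2 = 0" by (auto simp: power2_eq_iff)
      moreover have "y1 + y2 \<noteq> 0"
        using ysum(2) y0[OF e1] eval_at_to_fract(2)[of t 0] by auto
      ultimately show ?thesis using True by (simp add: P1 Q2)
    next
      case False
      define l where "l = (y1 + y2) / (x1 - x2)"
      define x3 where "x3 = l^2 - x1 - x2"
      have e3: "(y1 + l * (x3 - x1))^2 = x3^3 - tvar^2 * x3 + tvar^2"
        unfolding x3_def l_def by (rule chord_third_point[OF False e1 e2])
      note x3 = reg[OF e3]
      have "l * (x1 - x2) = y1 + y2" using False by (simp add: l_def)
      \<comment> \<open>As \<open>x3\<close> has no pole, the left side vanishes at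
        \<open>t\<close>, where \<open>x1\<close> and \<open>x2\<close> agree; the right side is
        \<open>(2 * eval_at t y1)^2\<close> there, which is nonzero.\<close>
      hence eq: "(x3 + x1 + x2) * (x1 - x2)^2 = (y1 + y2)^2" unfolding x3_def by algebra
      note d = eval_at_diff[OF x1 x2]
      note d2 = eval_at_power[OF d(1), of 2]
      note a1 = eval_at_add[OF x3 x1]
      note a2 = eval_at_add[OF a1(1) x2]
      have "eval_at t ((x3 + x1 + x2) * (x1 - x2)^2) = 0"
        using eval_at_mult[OF a2(1), of "(x1 - x2)^2"] d2 d ev by simp
      moreover have "eval_at t ((y1 + y2)^2) = (2 * eval_at t y1)^2"
        using eval_at_power[OF ysum(1), of 2] ysum(2) by simp
      ultimately show ?thesis using y0[OF e1] unfolding eq by simp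
    qed
  qed
  thus ?thesis unfolding t_def by (intro inj_onI) blast
qed

end
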